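(* The following hold. (a) $\mathfrak{b}(\mathcal{I},\mathcal{I},\mathrm{Fin})=\mathfrak{b}$ for every ideal $\mathcal{I}$ on $\omega$ which is $\leq_K$-below some $F_\sigma$ ideal. In particular, $\mathfrak{b}(\mathcal{I},\mathcal{I},\mathrm{Fin})=\mathfrak{b}$ for all $F_\sigma$ ideals and all analytic P-ideals generated by unbounded submeasures. (b) $\mathfrak{b}\leq\mathfrak{b}(\mathcal{I},\mathcal{I},\mathrm{Fin})\leq\mathfrak{d}$ for every weak P-ideal $\mathcal{I}$ on $\omega$.
   Context: An ideal on $\omega$ is a proper subfamily of $\mathcal{P}(\omega)$ closed under finite unions and subsets and containing all finite sets; $\mathrm{Fin}$ is the ideal of finite subsets of $\omega$. $\mathcal I$ is a weak P-ideal if for every partition $\{A_n:n\in\omega\}\subseteq\mathcal I$ of $\omega$ there is $A\notin\mathcal I$ with $A_n\cap A$ finite for all $n$; it is a P-ideal if for every $\{A_n:n\in\omega\}\subseteq\mathcal I$ there is $A\in\mathcal I$ with $A_n\setminus A$ finite for all $n$. $F_\sigma$ and analytic refer to the topology on $\mathcal P(\omega)\cong 2^\omega$. $\mathcal I\leq_K\mathcal J$ ($\mathcal I$ is $\leq_K$-below $\mathcal J$) means that there is $f:\omega\to\omega$ with $f^{-1}[A]\in\mathcal J$ for all $A\in\mathcal I$. A lower semicontinuous submeasure on $\omega$ is a map $\phi:\mathcal P(\omega)\to[0,\infty]$ with $\phi(\emptyset)=0$, $\phi(A)\le\phi(A\cup B)\le\phi(A)+\phi(B)$, $\phi(\{n\})<\infty$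 for all $n\in\omega$, and $\phi(A)=\lim_{n}\phi(A\cap\{0,\dots,n\})$ for all $A$. $\mathrm{Exh}(\phi)=\{A\subseteq\omega:\lim_n\phi(A\cap\{n,n+1,\dots\})=0\}$. An analytic P-ideal $\mathcal I$ is generated by an unbounded submeasure if $\mathcal I=\mathrm{Exh}(\phi)$ for some lower semicontinuous submeasure $\phi$ with $\phi(\omega)=\infty$. $\mathfrak b(\mathcal I,\mathcal I,\mathrm{Fin})$ is the minimal cardinality of a family $\mathcal E$ of sequences $(E_n)_{n\in\omega}$ of pairwise disjoint finite subsets of $\omega$ such that for every sequence $(A_n)_{n\in\omega}$ of pairwise disjoint (possibly empty) members of $\mathcal I$ with $\bigcup_nA_n=\omega$ there is $(E_n)\in\mathcal E$ with $\bigcup_{n\in\omega}\left(A_{n+1}\cap\bigcup_{i\le n}E_i\right)\notin\mathcal I$. $\mathfrak b$ and $\mathfrak d$ are the usual bounding and dominating numbers. *)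

theory Defs
  imports "HOL-Analysis.Analysis"
begin

unbundle cardinal_syntax

definition omega_ideal :: "nat set set \<Rightarrow> bool" where
  "omega_ideal I \<longleftrightarrow>
     I \<noteq> UNIV \<and>
     (\<forall>A. finite A \<longrightarrow> A \<in> I) \<and>
     (\<forall>A\<in>I. \<forall>B\<in>I. A \<union> B \<in> I) \<and>
     (\<forall>A\<in>I. \<forall>B. B \<subseteq> A \<longrightarrow> B \<in> I)"

definition weak_P_ideal :: "nat set set \<Rightarrow> bool" where
  "weak_P_ideal I \<longleftrightarrow> omega_ideal I \<and>
     (\<forall>A :: nat \<Rightarrow> nat set. range A \<subseteq> I \<and> partition_on UNIV (range A) \<longrightarrow>
        (\<exists>B. B \<notin> I \<and> (\<forall>n. finite (A n \<inter> B))))"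

definition P_ideal :: "nat set set \<Rightarrow> bool" where
  "P_ideal I \<longleftrightarrow> omega_ideal I \<and>
     (\<forall>A :: nat \<Rightarrow> nat set. range A \<subseteq> I \<longrightarrow>
        (\<exists>B\<in>I. \<forall>n. finite (A n - B)))"

text \<open>The image of a family of subsets under the identification of \<open>\<P>(\<omega>)\<close> with \<open>2\<^sup>\<omega>\<close>.  The types
  \<^typ>\<open>nat \<Rightarrow> bool\<close> and \<^typ>\<open>nat \<Rightarrow> nat\<close> carry the product topology of discrete spaces.\<close>

definition char_funs :: "nat set set \<Rightarrow> (nat \<Rightarrow> bool) set" where
  "char_funs I = (\<lambda>A n. n \<in> A) ` I"

definition F_sigma_family :: "nat set set \<Rightarrow> bool" where
  "F_sigma_family I \<longleftrightarrow> fsigma_in euclidean (char_funs I)"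

text \<open>Analytic: empty or a continuous image of the Baire space.\<close>

definition analytic_family :: "nat set set \<Rightarrow> bool" where
  "analytic_family I \<longleftrightarrow> I = {} \<or>
     (\<exists>f :: (nat \<Rightarrow> nat) \<Rightarrow> (nat \<Rightarrow> bool). continuous_on UNIV f \<and> range f = char_funs I)"

definition katetov_le :: "nat set set \<Rightarrow> nat set set \<Rightarrow> bool" (infix "\<le>\<^sub>K" 50) where
  "I \<le>\<^sub>K J \<longleftrightarrow> (\<exists>f :: nat \<Rightarrow> nat. \<forall>A\<in>I. f -` A \<in> J)"

definition lsc_submeasure :: "(nat set \<Rightarrow> ennreal) \<Rightarrow> bool" where
  "lsc_submeasure \<phi> \<longleftrightarrow>
     \<phi> {} = 0 \<and>
     (\<forall>A B. \<phi> A \<le> \<phi> (A \<union> B) \<and> \<phi> (A \<union> B) \<le> \<phi> A + \<phi> B) \<and>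
     (\<forall>n. \<phi> {n} < \<infinity>) \<and>
     (\<forall>A. (\<lambda>n. \<phi> (A \<inter> {0..n})) \<longlonglongrightarrow> \<phi> A)"

definition Exh :: "(nat set \<Rightarrow> ennreal) \<Rightarrow> nat set set" where
  "Exh \<phi> = {A. (\<lambda>n. \<phi> (A \<inter> {n..})) \<longlonglongrightarrow> 0}"

definition generated_by_unbounded_submeasure :: "nat set set \<Rightarrow> bool" where
  "generated_by_unbounded_submeasure I \<longleftrightarrow>
     (\<exists>\<phi>. lsc_submeasure \<phi> \<and> \<phi> UNIV = \<infinity> \<and> I = Exh \<phi>)"

text \<open>The minimal cardinality of a member of \<open>\<F>\<close>.  For empty \<open>\<F>\<close> there is no minimum and the
  value is the dummy cardinal 0; as the bounding number below is infinite, a cardinal that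
  equals it or lies above it is therefore a genuine minimum.\<close>

definition min_card :: "'a set set \<Rightarrow> 'a rel" where
  "min_card \<F> = (if \<F> = {} then |{}|
     else |SOME E. E \<in> \<F> \<and> (\<forall>E'\<in>\<F>. |E| \<le>o |E'| )| )"

lemma min_card_attained:
  assumes "\<F> \<noteq> {}"
  shows "\<exists>E\<in>\<F>. min_card \<F> = |E| \<and> (\<forall>E'\<in>\<F>. |E| \<le>o |E'| )"
proof -
  have "\<exists>r\<in>card_of ` \<F>. \<forall>r'\<in>card_of ` \<F>. r \<le>o r'"
    by (rule exists_minim_Card_order) (use assms in \<open>auto simp: card_of_Card_order\<close>)
  then have "\<exists>E. E \<in> \<F> \<and> (\<forall>E'\<in>\<F>. |E| \<le>o |E'| )" by auto
  from someI_ex[OF this] show ?thesis using assms by (auto simp: min_card_def)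
qed

definition b_ideal_families :: "nat set set \<Rightarrow> (nat \<Rightarrow> nat set) set set" where
  "b_ideal_families I =
     {\<E>. (\<forall>E\<in>\<E>. disjoint_family E \<and> (\<forall>n. finite (E n))) \<and>
          (\<forall>A :: nat \<Rightarrow> nat set. disjoint_family A \<and> range A \<subseteq> I \<and> (\<Union>n. A n) = UNIV \<longrightarrow>
             (\<exists>E\<in>\<E>. (\<Union>n. A (Suc n) \<inter> (\<Union>i\<le>n. E i)) \<notin> I))}"

text \<open>The cardinal \<open>\<bb>(I, I, Fin)\<close>.\<close>

definition b_ideal :: "nat set set \<Rightarrow> (nat \<Rightarrow> nat set) rel" where
  "b_ideal I = min_card (b_ideal_families I)"

definition le_star :: "(nat \<Rightarrow> nat) \<Rightarrow> (nat \<Rightarrow> nat) \<Rightarrow> bool" (infix "\<le>\<^sup>*" 50) where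
  "f \<le>\<^sup>* g \<longleftrightarrow> (\<forall>\<^sub>F n in sequentially. f n \<le> g n)"

definition bounding_number :: "(nat \<Rightarrow> nat) rel" where
  "bounding_number = min_card {F. \<not> (\<exists>g. \<forall>f\<in>F. f \<le>\<^sup>* g)}"

definition dominating_number :: "(nat \<Rightarrow> nat) rel" where
  "dominating_number = min_card {D. \<forall>f. \<exists>g\<in>D. f \<le>\<^sup>* g}"

end

(* The lower bound is realised by partitions of omega into finite intervals whose endpoints bound
   a given small family. For the upper bounds, a function g yields sequences E whose n-th partial
   unions cover the first g(n) points. If the ideal is a weak P-ideal, pick a positive set meeting
   every piece of the partition in a finite set and let g dominate the maxima of the traces.
   If it lies Katetov-below an F_sigma ideal J, the union of an increasing sequence of closed sets
   C(n), compactness gives v(n) such that the first v(n) points of the tail of the pulled back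
   partition beyond its n-th piece are contained in no member of C(n); a g with g(n) > v(n) for
   infinitely many n then defeats every C(n). *)
theory Submission
  imports Defs
begin

section \<open>Comparison of minimal cardinalities, and closure properties of ideals\<close>

lemma min_card_le_image:
  assumes "\<G> \<noteq> {}" and "\<And>G. G \<in> \<G> \<Longrightarrow> h ` G \<in> \<F>"
  shows "min_card \<F> \<le>o min_card \<G>"
proof -
  obtain G where G: "G \<in> \<G>" "min_card \<G> = |G|"
    using min_card_attained[OF assms(1)] by blast
  have "\<F> \<noteq> {}" using assms(2)[OF G(1)] by blast
  then have "min_card \<F> \<le>o |h ` G|"
    using min_card_attained[of \<F>] assms(2)[OF G(1)] by auto
  then show ?thesis using G(2) card_of_image ordLeq_transitive by metis
qed

text \<open>Together with the next lemma this makes \<open>bounding_number\<close> and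
  \<open>dominating_number\<close> genuine minima instead of the dummy value 0.\<close>

lemma unbounded_families_nonempty: "{F. \<not> (\<exists>g. \<forall>f\<in>F. f \<le>\<^sup>* g)} \<noteq> {}"
proof -
  have "\<not> (\<lambda>n. Suc (g n)) \<le>\<^sup>* g" for g
    by (auto simp: le_star_def eventually_sequentially)
  then have "UNIV \<in> {F. \<not> (\<exists>g. \<forall>f\<in>F. f \<le>\<^sup>* g)}" by blast
  then show ?thesis by blast
qed

lemma dominating_families_nonempty: "{D. \<forall>f. \<exists>g\<in>D. f \<le>\<^sup>* g} \<noteq> {}"
proof -
  have "f \<le>\<^sup>* f" for f
    by (simp add: le_star_def)
  then have "UNIV \<in> {D. \<forall>f. \<exists>g\<in>D. f \<le>\<^sup>* g}" by blast
  then show ?thesis by blast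
qed

lemma omega_ideal_finite: "omega_ideal I \<Longrightarrow> finite A \<Longrightarrow> A \<in> I"
  and omega_ideal_Un: "omega_ideal I \<Longrightarrow> A \<in> I \<Longrightarrow> B \<in> I \<Longrightarrow> A \<union> B \<in> I"
  and omega_ideal_subset: "omega_ideal I \<Longrightarrow> A \<in> I \<Longrightarrow> B \<subseteq> A \<Longrightarrow> B \<in> I"
  by (auto simp: omega_ideal_def)

lemma omega_ideal_UNIV: "omega_ideal I \<Longrightarrow> UNIV \<notin> I"
  by (auto simp: omega_ideal_def)

lemma omega_ideal_UN:
  assumes "omega_ideal I" "finite S" "\<And>i. i \<in> S \<Longrightarrow> A i \<in> I"
  shows "(\<Union>i\<in>S. A i) \<in> I"
  using assms(2,3)
  by (induction S rule: finite_induct) (auto intro: omega_ideal_Un omega_ideal_finite assms(1))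

lemma UN_atMost_disjointed: "(\<Union>i\<le>n. disjointed P i) = (\<Union>i\<le>n. P i)" for n :: nat
  using finite_UN_disjointed_eq[of P "Suc n"] by (simp add: atLeast0LessThan lessThan_Suc_atMost)

section \<open>The lower bound by \<open>bounding_number\<close>\<close>

lemma unbounded_of_b_ideal_family:
  assumes I: "omega_ideal I" and \<E>: "\<E> \<in> b_ideal_families I"
  shows "\<not> (\<exists>g. \<forall>f\<in>(\<lambda>E n. LEAST m. (\<Union>i\<le>n. E i) \<subseteq> {..<m}) ` \<E>. f \<le>\<^sup>* g)"
proof
  assume "\<exists>g. \<forall>f\<in>(\<lambda>E n. LEAST m. (\<Union>i\<le>n. E i) \<subseteq> {..<m}) ` \<E>. f \<le>\<^sup>* g"
  then obtain g where g: "\<And>E. E \<in> \<E> \<Longrightarrow> (\<lambda>n. LEAST m. (\<Union>i\<le>n. E i) \<subseteq> {..<m}) \<le>\<^sup>* g"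
    by blast
  \<comment> \<open>The pieces are consecutive, possibly empty intervals even if \<open>g\<close> is
    not monotone, since \<open>disjointed\<close> removes all earlier segments. Taking the maximum
    with \<open>n\<close> makes the segments exhaust \<omega>.\<close>
  define A where "A = disjointed (\<lambda>n. {..<max (g n) n})"
  have "disjoint_family A" unfolding A_def by (rule disjoint_family_disjointed)
  moreover have A_sub: "A n \<subseteq> {..<max (g n) n}" for n
    unfolding A_def by (rule disjointed_subset)
  then have "finite (A n)" for n by (rule finite_subset) simp
  then have "range A \<subseteq> I" using omega_ideal_finite[OF I] by blast
  moreover have "x \<in> {..<max (g (Suc x)) (Suc x)}" for x by simp
  then have "(\<Union>n. A n) = UNIV"
    unfolding A_def UN_disjointed_eq by blast
  ultimately obtain E where E: "E \<in> \<E>" "(\<Union>n. A (Suc n) \<inter> (\<Union>i\<le>n. E i)) \<notin> I"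
    using \<E> unfolding b_ideal_families_def by blast
  have bdd: "(\<Union>i\<le>n. E i) \<subseteq> {..<LEAST m. (\<Union>i\<le>n. E i) \<subseteq> {..<m}}" for n
  proof (rule LeastI_ex)
    have "finite (\<Union>i\<le>n. E i)" using \<E> E(1) by (auto simp: b_ideal_families_def)
    then show "\<exists>m. (\<Union>i\<le>n. E i) \<subseteq> {..<m}" by (simp add: finite_nat_iff_bounded)
  qed
  obtain N where N: "\<And>n. n \<ge> N \<Longrightarrow> (LEAST m. (\<Union>i\<le>n. E i) \<subseteq> {..<m}) \<le> g n"
    using g[OF E(1)] unfolding le_star_def eventually_sequentially by blast
  \<comment> \<open>Where \<open>g\<close> bounds the function of \<open>E\<close>, the sets
    \<open>E 0\<close>, ..., \<open>E n\<close> lie in a segment that the pieces up to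
    \<open>A n\<close> have used up. So only the finitely many indices below \<open>N\<close>
    contribute, each a finite set.\<close>
  have empty: "A (Suc n) \<inter> (\<Union>i\<le>n. E i) = {}" if "n \<ge> N" for n
  proof -
    have "(\<Union>i\<le>n. E i) \<subseteq> {..<max (g n) n}"
      using bdd[of n] N[OF that] by fastforce
    moreover have "A (Suc n) \<inter> {..<max (g n) n} = {}"
      unfolding A_def disjointed_def by (auto simp: less_Suc_eq)
    ultimately show ?thesis by blast
  qed
  have "(\<Union>n. A (Suc n) \<inter> (\<Union>i\<le>n. E i)) \<subseteq> (\<Union>n<N. A (Suc n))"
  proof (rule UN_least)
    fix n show "A (Suc n) \<inter> (\<Union>i\<le>n. E i) \<subseteq> (\<Union>n<N. A (Suc n))"
      using empty[of n] by (cases "n < N") auto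
  qed
  moreover have "finite (\<Union>n<N. A (Suc n))" using \<open>\<And>n. finite (A n)\<close> by blast
  ultimately show False using E(2) omega_ideal_finite[OF I] finite_subset by blast
qed

lemma bounding_number_le_b_ideal:
  assumes "omega_ideal I" "b_ideal_families I \<noteq> {}"
  shows "bounding_number \<le>o b_ideal I"
  unfolding bounding_number_def b_ideal_def
  using unbounded_of_b_ideal_family[OF assms(1)]
  by (intro min_card_le_image[where h = "\<lambda>E n. LEAST m. (\<Union>i\<le>n. E i) \<subseteq> {..<m}"] assms(2)) simp

section \<open>The upper bound by \<open>dominating_number\<close> for weak P-ideals\<close>

text \<open>Shared by both upper bounds: the positivity condition sees a sequence only through its
  partial unions, and \<open>disjointed\<close> preserves these. Hence pairwise disjointness comes
  for free.\<close>

lemma disjointed_family_in_b_ideal_families: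
  assumes "\<And>g n. finite (P g n)"
    and "\<And>A. \<lbrakk>disjoint_family A; range A \<subseteq> I; (\<Union>n. A n) = UNIV\<rbrakk> \<Longrightarrow>
           \<exists>g\<in>G. (\<Union>n. A (Suc n) \<inter> (\<Union>i\<le>n. P g i)) \<notin> I"
  shows "(\<lambda>g. disjointed (P g)) ` G \<in> b_ideal_families I"
proof -
  have "finite (disjointed (P g) n)" for g n
    using assms(1) disjointed_subset[of "P g" n] finite_subset by blast
  then show ?thesis
    using assms(2)
    by (auto simp: b_ideal_families_def UN_atMost_disjointed disjoint_family_disjointed)
qed

text \<open>Bridges two notions of partition: \<open>partition_on\<close> forbids empty pieces,
  while \<open>A\<close> may have some. The nonempty pieces are enumerated anew; repetitions, which
  occur if there are only finitely many, do no harm.\<close>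

lemma weak_P_ideal_positive_set:
  fixes A :: "nat \<Rightarrow> nat set"
  assumes I: "weak_P_ideal I" and A: "disjoint_family A" "range A \<subseteq> I" "(\<Union>n. A n) = UNIV"
  shows "\<exists>B. B \<notin> I \<and> (\<forall>n. finite (A n \<inter> B))"
proof -
  let ?R = "range A - {{}}"
  define A' where "A' = from_nat_into ?R"
  have "?R \<noteq> {}" using A(3) by fastforce
  then have r: "range A' = ?R" unfolding A'_def by (rule range_from_nat_into) auto
  have "partition_on UNIV ?R"
    using A(1,3) unfolding partition_on_def disjoint_def disjoint_family_on_def by fastforce
  moreover have "?R \<subseteq> I" using A(2) by blast
  ultimately obtain B where B: "B \<notin> I" "\<And>n. finite (A' n \<inter> B)"
    using I r unfolding weak_P_ideal_def by metis
  have "finite (A n \<inter> B)" for n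
  proof (cases "A n = {}")
    case False
    then have "A n \<in> range A'" using r by blast
    then show ?thesis using B(2) by auto
  qed simp
  with B(1) show ?thesis by blast
qed

lemma dominating_in_b_ideal_families:
  assumes I: "weak_P_ideal I" and D: "\<forall>f. \<exists>g\<in>D. f \<le>\<^sup>* g"
  shows "(\<lambda>g. disjointed (\<lambda>n. {..<g n})) ` D \<in> b_ideal_families I"
proof (rule disjointed_family_in_b_ideal_families)
  fix A :: "nat \<Rightarrow> nat set"
  assume A: "disjoint_family A" "range A \<subseteq> I" "(\<Union>n. A n) = UNIV"
  have oI: "omega_ideal I" using I by (simp add: weak_P_ideal_def)
  obtain B where B: "B \<notin> I" "\<And>n. finite (A n \<inter> B)"
    using weak_P_ideal_positive_set[OF I A] by blast
  have "\<forall>n. \<exists>m. A (Suc n) \<inter> B \<subseteq> {..<m}"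
    using B(2) by (simp add: finite_nat_iff_bounded)
  then obtain f where f: "\<And>n. A (Suc n) \<inter> B \<subseteq> {..<f n}" by metis
  obtain g where g: "g \<in> D" "f \<le>\<^sup>* g" using D by blast
  then obtain N where N: "\<And>n. n \<ge> N \<Longrightarrow> f n \<le> g n"
    unfolding le_star_def eventually_sequentially by blast
  let ?Z = "\<Union>n. A (Suc n) \<inter> (\<Union>i\<le>n. {..<g i})"
  \<comment> \<open>A point of \<open>B\<close> in a piece \<open>A (Suc n)\<close> with
    \<open>n \<ge> N\<close> lies below \<open>f n \<le> g n\<close>, hence in \<open>?Z\<close>.
    The remaining pieces, including \<open>A 0\<close>, which \<open>?Z\<close> never meets, are
    finitely many members of \<open>I\<close>.\<close>
  have "B \<subseteq> (\<Union>n\<le>N. A n) \<union> ?Z"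
  proof
    fix x assume x: "x \<in> B"
    obtain k where k: "x \<in> A k" using A(3) by blast
    show "x \<in> (\<Union>n\<le>N. A n) \<union> ?Z"
    proof (cases "k \<le> N")
      case False
      then obtain n where n: "k = Suc n" "n \<ge> N" by (cases k) auto
      then have "x < g n" using f[of n] N[of n] x k by fastforce
      then show ?thesis using n k by auto
    qed (use k in auto)
  qed
  moreover have "(\<Union>n\<le>N. A n) \<in> I" using A(2) by (intro omega_ideal_UN oI) auto
  ultimately have "?Z \<notin> I" using B(1) omega_ideal_Un[OF oI] omega_ideal_subset[OF oI] by blast
  then show "\<exists>g\<in>D. (\<Union>n. A (Suc n) \<inter> (\<Union>i\<le>n. {..<g i})) \<notin> I" using g(1) by blast
qed simp

(* For a hereditary J this says that J is F_sigma, with C(n) closed: compactness turns closedness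
   into the finite refutation property. *)
definition sigma_finitely_refutable :: "nat set set \<Rightarrow> bool" where
  "sigma_finitely_refutable J \<longleftrightarrow>
     (\<exists>C :: nat \<Rightarrow> nat set set. mono C \<and> J \<subseteq> (\<Union>n. C n) \<and>
        (\<forall>Y n. Y \<notin> J \<longrightarrow> (\<exists>m. \<forall>X\<in>C n. \<not> Y \<inter> {..<m} \<subseteq> X)))"

section \<open>The equality with \<open>bounding_number\<close> below a finitely refutable
  ideal\<close>

lemma unbounded_in_b_ideal_families:
  assumes J: "omega_ideal J" "sigma_finitely_refutable J"
    and f: "\<And>A. A \<in> I \<Longrightarrow> f -` A \<in> J"
    and F: "\<not> (\<exists>g. \<forall>f\<in>F. f \<le>\<^sup>* g)"
  shows "(\<lambda>g. disjointed (\<lambda>n. f ` {..<g n})) ` F \<in> b_ideal_families I"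
proof (rule disjointed_family_in_b_ideal_families)
  fix A :: "nat \<Rightarrow> nat set"
  assume A: "disjoint_family A" "range A \<subseteq> I" "(\<Union>n. A n) = UNIV"
  obtain C :: "nat \<Rightarrow> nat set set" where C: "mono C" "J \<subseteq> (\<Union>n. C n)"
    and escape: "\<And>Y n. Y \<notin> J \<Longrightarrow> \<exists>m. \<forall>X\<in>C n. \<not> Y \<inter> {..<m} \<subseteq> X"
    using J(2) unfolding sigma_finitely_refutable_def by blast
  \<comment> \<open>\<open>T n\<close> is the preimage of the pieces with index above
    \<open>n\<close>. It is positive because finitely many preimages in \<open>J\<close> form its
    complement.\<close>
  define T where "T n = - (\<Union>i\<le>n. f -` A i)" for n
  have "T n \<notin> J" for n
  proof
    assume "T n \<in> J"
    moreover have "(\<Union>i\<le>n. f -` A i) \<in> J"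
      using A(2) f by (intro omega_ideal_UN J(1)) auto
    ultimately have "T n \<union> (\<Union>i\<le>n. f -` A i) \<in> J" by (rule omega_ideal_Un[OF J(1)])
    then show False using omega_ideal_UNIV[OF J(1)] unfolding T_def Compl_partition2 by blast
  qed
  then have "\<forall>n. \<exists>m. \<forall>X\<in>C n. \<not> T n \<inter> {..<m} \<subseteq> X"
    using escape by blast
  then obtain v where v: "\<And>n X. X \<in> C n \<Longrightarrow> \<not> T n \<inter> {..<v n} \<subseteq> X" by metis
  obtain g where g: "g \<in> F" "\<not> g \<le>\<^sup>* v" using F by blast
  let ?Z = "\<Union>n. A (Suc n) \<inter> (\<Union>i\<le>n. f ` {..<g i})"
  have "?Z \<notin> I"
  proof
    assume "?Z \<in> I"
    then obtain k where k: "f -` ?Z \<in> C k" using f C(2) by blast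
    \<comment> \<open>Since \<open>v\<close> does not dominate \<open>g\<close>, such
      \<open>n\<close> exist beyond any \<open>k\<close>; as \<open>C\<close> increases,
      \<open>C n\<close> also contains the preimage of \<open>?Z\<close>, which \<open>v n\<close>
      refutes.\<close>
    obtain n where n: "n \<ge> k" "v n < g n"
      using g(2) unfolding le_star_def eventually_sequentially by (meson not_le)
    have "T n \<inter> {..<v n} \<subseteq> f -` ?Z"
    proof
      fix x assume x: "x \<in> T n \<inter> {..<v n}"
      obtain j where j: "f x \<in> A j" using A(3) by blast
      with x have "j > n" by (fastforce simp: T_def)
      then obtain l where l: "j = Suc l" "l \<ge> n" by (cases j) auto
      \<comment> \<open>The point \<open>x\<close> counts the first \<open>g n\<close> points on the
        side of \<open>J\<close>; its image lies in the set of index \<open>n\<close>, which enters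
        the partial union at \<open>l \<ge> n\<close>.\<close>
      have "f x \<in> f ` {..<g n}" using x n(2) by auto
      then show "x \<in> f -` ?Z" using j l by blast
    qed
    moreover have "f -` ?Z \<in> C n" using k n(1) C(1) by (auto dest: monoD)
    ultimately show False using v by blast
  qed
  then show "\<exists>g\<in>F. (\<Union>n. A (Suc n) \<inter> (\<Union>i\<le>n. f ` {..<g i})) \<notin> I" using g(1) by blast
qed simp

lemma b_ideal_eq_bounding_number:
  assumes I: "omega_ideal I" and J: "omega_ideal J" "sigma_finitely_refutable J" "I \<le>\<^sub>K J"
  shows "b_ideal I =o bounding_number"
proof -
  obtain f where f: "\<And>A. A \<in> I \<Longrightarrow> f -` A \<in> J" using J(3) unfolding katetov_le_def by blast
  note E = unbounded_in_b_ideal_families[OF J(1,2) f]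
  have "b_ideal I \<le>o bounding_number"
    unfolding bounding_number_def b_ideal_def
    by (rule min_card_le_image[OF unbounded_families_nonempty E]) auto
  \<comment> \<open>The lower bound would fail for the dummy value, so a member is
    exhibited.\<close>
  moreover have "b_ideal_families I \<noteq> {}"
    using unbounded_families_nonempty E by blast
  ultimately show ?thesis
    using bounding_number_le_b_ideal[OF I] by (simp add: ordIso_iff_ordLeq)
qed

section \<open>Finite refutability of \<open>F_sigma\<close> ideals\<close>

lemma compact_UNIV_nat_bool: "compact (UNIV :: (nat \<Rightarrow> bool) set)"
proof -
  have "compact_space (euclidean :: bool topology)"
    by (simp add: compact_space_def finite_imp_compact)
  then have "compact_space (product_topology (\<lambda>_::nat. euclidean :: bool topology) UNIV)"
    by (simp add: compact_space_product_topology)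
  then show ?thesis
    by (simp add: euclidean_product_topology compact_space_def)
qed

lemma open_apply_bool: "open {x :: nat \<Rightarrow> bool. x i = b}"
proof -
  have "open ((\<lambda>x :: nat \<Rightarrow> bool. x i) -` {b})"
    by (intro open_vimage continuous_on_product_coordinates open_discrete)
  then show ?thesis by (simp add: vimage_def)
qed

lemma F_sigma_sigma_finitely_refutable:
  assumes J: "omega_ideal J" "F_sigma_family J"
  shows "sigma_finitely_refutable J"
proof -
  obtain K :: "nat \<Rightarrow> (nat \<Rightarrow> bool) set"
    where K: "\<And>n. closed (K n)" "\<And>n. K n \<subseteq> K (Suc n)" "(\<Union>n. K n) = char_funs J"
    using J(2) unfolding F_sigma_family_def fsigma_in_ascending by auto
  define C where "C n = {X. (\<lambda>i. i \<in> X) \<in> K n}" for n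
  have "mono C"
    using K(2) by (intro incseq_SucI) (auto simp: C_def)
  moreover have "J \<subseteq> (\<Union>n. C n)"
    using K(3) by (auto simp: C_def char_funs_def)
  moreover have "\<exists>m. \<forall>X\<in>C n. \<not> Y \<inter> {..<m} \<subseteq> X" if Y: "Y \<notin> J" for Y n
  proof -
    \<comment> \<open>As \<open>J\<close> is hereditary, no member of \<open>J\<close> contains
      \<open>Y\<close>, so each omits a point of \<open>Y\<close>. A finite subcover of the compact
      set \<open>K n\<close> confines the omitted points to a finite part of
      \<open>Y\<close>.\<close>
    have cover: "K n \<subseteq> (\<Union>i\<in>Y. {x. x i = False})"
    proof
      fix x assume "x \<in> K n"
      then obtain X where X: "X \<in> J" "x = (\<lambda>i. i \<in> X)"
        using K(3) unfolding char_funs_def by blast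
      then have "\<not> Y \<subseteq> X" using Y omega_ideal_subset[OF J(1)] by blast
      then show "x \<in> (\<Union>i\<in>Y. {x. x i = False})" using X(2) by blast
    qed
    have "compact (K n)" using compact_Int_closed[OF compact_UNIV_nat_bool K(1)] by simp
    then obtain S where S: "S \<subseteq> Y" "finite S" "K n \<subseteq> (\<Union>i\<in>S. {x. x i = False})"
      by (rule compactE_image[OF _ _ cover]) (rule open_apply_bool)
    obtain m where m: "S \<subseteq> {..<m}" using S(2) by (auto simp: finite_nat_iff_bounded)
    have "\<not> Y \<inter> {..<m} \<subseteq> X" if "X \<in> C n" for X
      using that S(1,3) m unfolding C_def by fastforce
    then show ?thesis by blast
  qed
  ultimately show ?thesis unfolding sigma_finitely_refutable_def by blast
qed

section \<open>Submeasures and their exhaustive ideals\<close>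

context
  fixes \<phi> assumes \<phi>: "lsc_submeasure \<phi>"
begin

lemma submeasure_mono: "A \<subseteq> B \<Longrightarrow> \<phi> A \<le> \<phi> B"
  using \<phi> unfolding lsc_submeasure_def by (metis sup.absorb2)

lemma submeasure_Un: "\<phi> (A \<union> B) \<le> \<phi> A + \<phi> B"
  using \<phi> unfolding lsc_submeasure_def by blast

lemma submeasure_finite:
  assumes "finite A"
  shows "\<phi> A < \<infinity>"
  using assms
proof (induction A rule: finite_induct)
  case empty
  then show ?case using \<phi> by (simp add: lsc_submeasure_def)
next
  case (insert x A)
  have "\<phi> {x} < \<infinity>" using \<phi> by (simp add: lsc_submeasure_def)
  then have "\<phi> {x} + \<phi> A < \<infinity>" using insert.IH by simp
  then show ?case using submeasure_Un[of "{x}" A] by (simp add: le_less_trans)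
qed

lemma Fin_omega_ideal:
  assumes "\<phi> UNIV = \<infinity>"
  shows "omega_ideal {A. \<phi> A < \<infinity>}"
proof -
  have "\<phi> (A \<union> B) < \<infinity>" if "\<phi> A < \<infinity>" "\<phi> B < \<infinity>" for A B
    using le_less_trans[OF submeasure_Un] that by simp
  moreover have "\<phi> B < \<infinity>" if "\<phi> A < \<infinity>" "B \<subseteq> A" for A B
    using le_less_trans[OF submeasure_mono] that by blast
  moreover have "{A. \<phi> A < \<infinity>} \<noteq> UNIV" using assms by (metis UNIV_I mem_Collect_eq order_less_irrefl)
  ultimately show ?thesis
    using submeasure_finite unfolding omega_ideal_def by blast
qed

text \<open>The sublevel sets of \<phi> serve as \<open>C\<close>. Lower semicontinuity gives a set
  of infinite submeasure an initial segment of submeasure above \<open>n\<close>, and by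
  monotonicity no set of submeasure at most \<open>n\<close> contains that segment.\<close>

lemma Fin_sigma_finitely_refutable: "sigma_finitely_refutable {A. \<phi> A < \<infinity>}"
proof -
  define C where "C n = {A. \<phi> A \<le> of_nat n}" for n :: nat
  have "mono C"
    unfolding C_def by (intro monoI) (auto intro: order_trans)
  moreover have "{A. \<phi> A < \<infinity>} \<subseteq> (\<Union>n. C n)"
    unfolding C_def infinity_ennreal_def by (blast dest: ennreal_Ex_less_of_nat intro: less_imp_le)
  moreover have "\<exists>m. \<forall>X\<in>C n. \<not> Y \<inter> {..<m} \<subseteq> X" if "\<not> \<phi> Y < \<infinity>" for Y n
  proof -
    have "(\<lambda>m. \<phi> (Y \<inter> {0..m})) \<longlonglongrightarrow> \<phi> Y" using \<phi> by (simp add: lsc_submeasure_def)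
    moreover have "\<phi> Y > of_nat n"
      using that of_nat_less_top[of n] by (simp add: less_top[symmetric])
    ultimately have "\<forall>\<^sub>F m in sequentially. \<phi> (Y \<inter> {0..m}) > of_nat n"
      by (rule order_tendstoD)
    then obtain m where "\<phi> (Y \<inter> {0..m}) > of_nat n"
      using eventually_happens'[OF sequentially_bot] by blast
    then have "\<phi> (Y \<inter> {..<Suc m}) > of_nat n"
      by (simp add: atLeast0AtMost lessThan_Suc_atMost)
    then have "\<not> Y \<inter> {..<Suc m} \<subseteq> X" if "X \<in> C n" for X
      using that submeasure_mono[of "Y \<inter> {..<Suc m}" X] unfolding C_def
      by (metis leD mem_Collect_eq order_trans)
    then show ?thesis by blast
  qed
  ultimately show ?thesis unfolding sigma_finitely_refutable_def by blast
qed

text \<open>A member splits into a finite set and a tail of submeasure below 1.\<close>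

lemma Exh_subset_Fin: "Exh \<phi> \<subseteq> {A. \<phi> A < \<infinity>}"
proof
  fix A assume "A \<in> Exh \<phi>"
  then have "\<forall>\<^sub>F n in sequentially. \<phi> (A \<inter> {n..}) < 1"
    unfolding Exh_def by (auto intro: order_tendstoD)
  then obtain n where n: "\<phi> (A \<inter> {n..}) < 1"
    using eventually_happens'[OF sequentially_bot] by blast
  have "A = (A \<inter> {..<n}) \<union> (A \<inter> {n..})" by auto
  then have "\<phi> A \<le> \<phi> (A \<inter> {..<n}) + \<phi> (A \<inter> {n..})" using submeasure_Un by metis
  also have "\<dots> < \<infinity>"
    using submeasure_finite[of "A \<inter> {..<n}"] less_trans[OF n, of \<infinity>] by simp
  finally show "A \<in> {A. \<phi> A < \<infinity>}" by simp
qed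

end

lemma katetov_le_subset: "I \<subseteq> J \<Longrightarrow> I \<le>\<^sub>K J"
  unfolding katetov_le_def by (rule exI[of _ id]) auto

theorem corollary2p10:
  shows "((\<forall>I. omega_ideal I \<and> (\<exists>J. omega_ideal J \<and> F_sigma_family J \<and> I \<le>\<^sub>K J)
              \<longrightarrow> b_ideal I =o bounding_number) \<and>
          (\<forall>I. omega_ideal I \<and> F_sigma_family I \<longrightarrow> b_ideal I =o bounding_number) \<and>
          (\<forall>I. P_ideal I \<and> analytic_family I \<and> generated_by_unbounded_submeasure I
              \<longrightarrow> b_ideal I =o bounding_number)) \<and>
         (\<forall>I. weak_P_ideal I
              \<longrightarrow> bounding_number \<le>o b_ideal I \<and> b_ideal I \<le>o dominating_number)"
proof (intro conjI allI impI; (elim conjE exE)?)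
  fix I J assume "omega_ideal I" "omega_ideal J" "F_sigma_family J" "I \<le>\<^sub>K J"
  then show "b_ideal I =o bounding_number"
    using b_ideal_eq_bounding_number F_sigma_sigma_finitely_refutable by blast
next
  fix I assume "omega_ideal I" "F_sigma_family I"
  then show "b_ideal I =o bounding_number"
    using b_ideal_eq_bounding_number F_sigma_sigma_finitely_refutable katetov_le_subset by blast
next
  fix I assume I: "P_ideal I" "generated_by_unbounded_submeasure I"
  then obtain \<phi> where \<phi>: "lsc_submeasure \<phi>" "\<phi> UNIV = \<infinity>" "I = Exh \<phi>"
    unfolding generated_by_unbounded_submeasure_def by blast
  \<comment> \<open>The ideal of sets of finite submeasure plays the part of \<open>J\<close>, with
    the identity as Katetov map; it is proper because \<phi> is unbounded.\<close>
  have "I \<le>\<^sub>K {A. \<phi> A < \<infinity>}"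
    using Exh_subset_Fin[OF \<phi>(1)] \<phi>(3) by (intro katetov_le_subset) simp
  moreover have "omega_ideal I" using I(1) by (simp add: P_ideal_def)
  ultimately show "b_ideal I =o bounding_number"
    using b_ideal_eq_bounding_number Fin_omega_ideal[OF \<phi>(1,2)]
      Fin_sigma_finitely_refutable[OF \<phi>(1)] by blast
next
  fix I assume I: "weak_P_ideal I"
  \<comment> \<open>A dominating family supplies the member that excludes the dummy value.\<close>
  then have "b_ideal_families I \<noteq> {}"
    using dominating_in_b_ideal_families dominating_families_nonempty by blast
  then show "bounding_number \<le>o b_ideal I"
    using I by (intro bounding_number_le_b_ideal) (simp_all add: weak_P_ideal_def)
next
  fix I assume I: "weak_P_ideal I"
  show "b_ideal I \<le>o dominating_number"
    unfolding dominating_number_def b_ideal_def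
    by (rule min_card_le_image[OF dominating_families_nonempty dominating_in_b_ideal_families[OF I]])
      simp
qed

end
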